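(* Let $0\ne\mu\in\mathfrak{so}(3)^*$ and let $$U=\Big\{(\nu,\operatorname{ad}^*_\eta\mu)\in\mathfrak{so}(3)_\mu^*\times T_\mu\mathcal O_\mu:\ \nu>-\|\mu\|\ \text{ and }\ \|\eta\|<2\sqrt{\tfrac{\|\mu+\nu\|}{\|\mu\|}}\Big\},$$ where $\eta\in\mathfrak{so}(3)_\mu^\perp$. Define $\Phi:SO(3)\times U\to SO(3)\times\mathfrak{so}(3)^*$ by $$\Phi(g,\nu,\operatorname{ad}^*_\eta\mu)=\Big(gF(\nu,\eta)^{-1},\ \operatorname{Ad}^*_{F(\nu,\eta)^{-1}}(\mu+\nu)\Big),$$ where $$F(\nu,\eta)=\exp\left(2\arcsin\left(\tfrac12\|\eta\|\sqrt{\frac{\|\mu\|}{\|\mu+\nu\|}}\right)\frac{\eta}{\|\eta\|}\right)$$ (with $F(\nu,0)=I$). Then $\Phi^*\Omega_c=\Omega_Y$ on $SO(3)\times U$.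
   Context: Let $G=SO(3)$, $\mathfrak g=\mathfrak{so}(3)$. Identify $\mathfrak{so}(3)\cong\mathbb R^3$ by the hat map $\mathbf v\mapsto\hat{\mathbf v}$, $\hat{\mathbf v}\mathbf w=\mathbf v\times\mathbf w$, so the bracket is the cross product, and identify $\mathfrak{so}(3)^*\cong\mathbb R^3$ by the dot product; $\|\cdot\|$ is the Euclidean norm and $\exp$ the matrix exponential (of the hat matrix). Conventions: $\langle\operatorname{ad}^*_\eta\mu,\xi\rangle=\langle\mu,[\eta,\xi]\rangle$; $\operatorname{Ad}^*_{g^{-1}}\nu$ is the coadjoint action of $g$ on $\nu$ (i.e. $g\nu$ in $\mathbb R^3$). $\mathfrak g_\mu=\{\xi:\operatorname{ad}^*_\xi\mu=0\}=\mathbb R\mu$, and $\mathfrak g_\mu^\perp$ is its orthogonal complement. $\mathfrak g_\mu^*$ is identified with the elements of $\mathfrak g^*$ annihilating $\mathfrak g_\mu^\perp$, i.e. with $\mathbb R\mu$, and also with $\mathbb R$ via the real number $\nu\leftrightarrow\nu\,\mu/\|\mu\|$ (this gives meaning to $\nu>-\|\mu\|$). $\mathcal O_\mu$ is the coadjoint orbit of $\mu$, $T_\mu\mathcal O_\mu=\{\operatorname{ad}^*_\eta\mu:\eta\in\mathfrak g_\mu^\perp\}$, and $\eta\mapsto\operatorname{ad}^*_\eta\mu$ is an isomorphism from $\mathfrak g_\mu^\perp$. $\xi^\mu$ denotes the $\mathfrak g_\mu$-component of $\xi\in\mathfrak g$. $T^*G\cong G\times\mathfrak g^*$ by left-trivialisation,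 and tangent vectors to $G$ are left-trivialised. The canonical symplectic form is $$\Omega_c(g,\nu)((\xi_1,\rho_1),(\xi_2,\rho_2))=\langle\nu,[\xi_1,\xi_2]\rangle+\langle\rho_2,\xi_1\rangle-\langle\rho_1,\xi_2\rangle ,$$ and the form $\Omega_Y$ on $G\times\mathfrak g_\mu^*\times T_\mu\mathcal O_\mu$ is, at $(g,\nu,\rho)$, $$\Omega_Y\big((\xi_1,\dot\nu_1,\operatorname{ad}^*_{\zeta_1}\mu),(\xi_2,\dot\nu_2,\operatorname{ad}^*_{\zeta_2}\mu)\big)=\langle\mu+\nu,[\xi_1,\xi_2]\rangle+\langle\dot\nu_2,\xi_1^\mu\rangle-\langle\dot\nu_1,\xi_2^\mu\rangle-\langle\mu,[\zeta_1,\zeta_2]\rangle$$ for $\xi_i\in\mathfrak g$, $\dot\nu_i\in\mathfrak g_\mu^*$, $\zeta_i\in\mathfrak g_\mu^\perp$. *)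

theory Defs
  imports "HOL-Analysis.Analysis"
begin

unbundle no cross3_syntax and set_product_syntax

type_synonym R3 = "real^3"
type_synonym M3 = "real^3^3"

definition SO3 :: "M3 set" where
  "SO3 = {g. rotation_matrix g}"

definition hat :: "R3 \<Rightarrow> M3" where
  "hat v = matrix (cross3 v)"

text \<open>Only meaningful on skew-symmetric matrices, the range of \<^term>\<open>hat\<close>.\<close>
definition vee :: "M3 \<Rightarrow> R3" where
  "vee = inv hat"

text \<open>Multiplication on \<^typ>\<open>real^'n^'n\<close> is componentwise, so neither \<^const>\<open>power\<close> nor
  \<^const>\<open>exp\<close> can be used for the matrix exponential.\<close>
definition mat_exp :: "real^'n^'n \<Rightarrow> real^'n^'n" where
  "mat_exp A = (\<Sum>k. (1 / fact k) *\<^sub>R ((((**) A) ^^ k) (mat 1)))"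

text \<open>Lie algebra and its dual are both \<^typ>\<open>R3\<close>, paired by the inner product; the bracket
  is \<^const>\<open>cross3\<close>. Hence the dual of a linear map is its \<^const>\<open>adjoint\<close>.\<close>
definition ad_star :: "R3 \<Rightarrow> R3 \<Rightarrow> R3" where
  "ad_star \<eta> \<mu> = adjoint (cross3 \<eta>) \<mu>"

definition Ad :: "M3 \<Rightarrow> R3 \<Rightarrow> R3" where
  "Ad g \<xi> = vee (g ** hat \<xi> ** matrix_inv g)"

text \<open>The dual of \<^term>\<open>Ad g\<close>; thus \<open>Ad_star (matrix_inv g) \<nu> = g *v \<nu>\<close> for \<open>g\<close> in \<^term>\<open>SO3\<close>.\<close>
definition Ad_star :: "M3 \<Rightarrow> R3 \<Rightarrow> R3" where
  "Ad_star g \<nu> = adjoint (Ad g) \<nu>"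

definition isotropy :: "R3 \<Rightarrow> R3 set" where
  "isotropy \<mu> = {\<xi>. ad_star \<xi> \<mu> = 0}"

definition isotropy_perp :: "R3 \<Rightarrow> R3 set" where
  "isotropy_perp \<mu> = (isotropy \<mu>)\<^sup>\<bottom>"

definition isotropy_dual :: "R3 \<Rightarrow> R3 set" where
  "isotropy_dual \<mu> = {\<nu>. \<forall>\<xi>\<in>isotropy_perp \<mu>. \<nu> \<bullet> \<xi> = 0}"

text \<open>The real number \<open>r\<close> with \<open>\<nu> = r \<mu> / \<parallel>\<mu>\<parallel>\<close>.\<close>
definition dual_coord :: "R3 \<Rightarrow> R3 \<Rightarrow> real" where
  "dual_coord \<mu> \<nu> = (THE r. \<nu> = (r / norm \<mu>) *\<^sub>R \<mu>)"

definition isotropy_part :: "R3 \<Rightarrow> R3 \<Rightarrow> R3" where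
  "isotropy_part \<mu> \<xi> = (THE \<zeta>. \<zeta> \<in> isotropy \<mu> \<and> \<xi> - \<zeta> \<in> isotropy_perp \<mu>)"

definition tangent_orbit :: "R3 \<Rightarrow> R3 set" where
  "tangent_orbit \<mu> = {ad_star \<eta> \<mu> | \<eta>. \<eta> \<in> isotropy_perp \<mu>}"

text \<open>The inverse of the isomorphism \<open>\<eta> \<mapsto> ad_star \<eta> \<mu>\<close> from \<^term>\<open>isotropy_perp \<mu>\<close> onto
  \<^term>\<open>tangent_orbit \<mu>\<close>.\<close>
definition orbit_gen :: "R3 \<Rightarrow> R3 \<Rightarrow> R3" where
  "orbit_gen \<mu> = inv_into (isotropy_perp \<mu>) (\<lambda>\<eta>. ad_star \<eta> \<mu>)"

definition U_dom :: "R3 \<Rightarrow> (R3 \<times> R3) set" where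
  "U_dom \<mu> = {(\<nu>, ad_star \<eta> \<mu>) | \<nu> \<eta>.
     \<nu> \<in> isotropy_dual \<mu> \<and> \<eta> \<in> isotropy_perp \<mu> \<and>
     dual_coord \<mu> \<nu> > - norm \<mu> \<and> norm \<eta> < 2 * sqrt (norm (\<mu> + \<nu>) / norm \<mu>)}"

definition F_rot :: "R3 \<Rightarrow> R3 \<Rightarrow> R3 \<Rightarrow> M3" where
  "F_rot \<mu> \<nu> \<eta> =
     (if \<eta> = 0 then mat 1
      else mat_exp (hat
        ((2 * arcsin (1/2 * norm \<eta> * sqrt (norm \<mu> / norm (\<mu> + \<nu>)))) *\<^sub>R (\<eta> /\<^sub>R norm \<eta>))))"

definition \<Phi> :: "R3 \<Rightarrow> M3 \<times> R3 \<times> R3 \<Rightarrow> M3 \<times> R3" where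
  "\<Phi> \<mu> = (\<lambda>(g, \<nu>, \<rho>).
     let h = matrix_inv (F_rot \<mu> \<nu> (orbit_gen \<mu> \<rho>)) in (g ** h, Ad_star h (\<mu> + \<nu>)))"

definition \<Omega>_c :: "M3 \<times> R3 \<Rightarrow> R3 \<times> R3 \<Rightarrow> R3 \<times> R3 \<Rightarrow> real" where
  "\<Omega>_c = (\<lambda>(g, \<nu>) (\<xi>1, \<rho>1) (\<xi>2, \<rho>2).
     \<nu> \<bullet> cross3 \<xi>1 \<xi>2 + \<rho>2 \<bullet> \<xi>1 - \<rho>1 \<bullet> \<xi>2)"

definition \<Omega>_Y :: "R3 \<Rightarrow> M3 \<times> R3 \<times> R3 \<Rightarrow>
    R3 \<times> R3 \<times> R3 \<Rightarrow> R3 \<times> R3 \<times> R3 \<Rightarrow> real" where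
  "\<Omega>_Y \<mu> = (\<lambda>(g, \<nu>, \<rho>) (\<xi>1, \<nu>1, \<sigma>1) (\<xi>2, \<nu>2, \<sigma>2).
     (\<mu> + \<nu>) \<bullet> cross3 \<xi>1 \<xi>2
     + \<nu>2 \<bullet> isotropy_part \<mu> \<xi>1 - \<nu>1 \<bullet> isotropy_part \<mu> \<xi>2
     - \<mu> \<bullet> cross3 (orbit_gen \<mu> \<sigma>1) (orbit_gen \<mu> \<sigma>2))"

text \<open>Left-trivialisation: the tangent vector \<open>g ** hat \<xi>\<close> at \<open>g\<close> is represented by \<open>\<xi>\<close>.
  The first function passes from left-trivialised to actual (ambient) tangent vectors of a product
  of \<^term>\<open>SO3\<close> with a subset of a vector space, the second one back.\<close>
definition from_left :: "M3 \<times> 'a \<Rightarrow> R3 \<times> 'b \<Rightarrow> M3 \<times> 'b" where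
  "from_left = (\<lambda>(g, _) (\<xi>, w). (g ** hat \<xi>, w))"

definition to_left :: "M3 \<times> 'a \<Rightarrow> M3 \<times> 'b \<Rightarrow> R3 \<times> 'b" where
  "to_left = (\<lambda>(g, _) (V, w). (vee (matrix_inv g ** V), w))"

text \<open>The derivative relative to an embedded submanifold \<open>S\<close> is not unique as a linear map on the
  ambient space, but its restriction to the vectors tangent to \<open>S\<close> is.\<close>
definition tangent_map ::
  "(M3 \<times> 'a::real_normed_vector \<Rightarrow> M3 \<times> 'b::real_normed_vector) \<Rightarrow>
   (M3 \<times> 'a) set \<Rightarrow> M3 \<times> 'a \<Rightarrow> R3 \<times> 'a \<Rightarrow> R3 \<times> 'b" where
  "tangent_map f S p v =
     to_left (f p) (frechet_derivative f (at p within S) (from_left p v))"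

definition pullback_form ::
  "(M3 \<times> 'a::real_normed_vector \<Rightarrow> M3 \<times> 'b::real_normed_vector) \<Rightarrow>
   (M3 \<times> 'a) set \<Rightarrow>
   (M3 \<times> 'b \<Rightarrow> R3 \<times> 'b \<Rightarrow> R3 \<times> 'b \<Rightarrow> real) \<Rightarrow>
   M3 \<times> 'a \<Rightarrow> R3 \<times> 'a \<Rightarrow> R3 \<times> 'a \<Rightarrow> real" where
  "pullback_form f S \<omega> p v w = \<omega> (f p) (tangent_map f S p v) (tangent_map f S p w)"

end

theory Submission
  imports Defs
begin

text \<open>The half angle in \<open>F(\<nu>, \<eta>)\<close> has sine \<open>\<bar>b\<bar>\<close> with \<open>b = \<eta> / (2 \<surd>\<kappa>)\<close>, where \<open>\<mu> + \<nu> = \<kappa> \<mu>\<close>. So \<open>F\<close> is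
  the rotation of the unit quaternion \<open>(\<surd>(1 - \<bar>b\<bar>\<^sup>2), b)\<close>, a function smooth on the open unit ball.
  With \<open>A\<close> the left-trivialised derivative of \<open>F\<close>, the tangent map of \<open>\<Phi>\<close> sends \<open>(\<xi>, \<nu>')\<close> to
  \<open>(F (\<xi> - A), F (A \<times> (\<mu> + \<nu>) + \<nu>'))\<close>, and by rotation invariance the pulled back form differs from
  \<open>\<langle>\<mu> + \<nu>, [\<xi>\<^sub>1, \<xi>\<^sub>2]\<rangle> + \<langle>\<nu>\<^sub>2, \<xi>\<^sub>1\<rangle> - \<langle>\<nu>\<^sub>1, \<xi>\<^sub>2\<rangle>\<close> only by terms in \<open>A\<^sub>1\<close>, \<open>A\<^sub>2\<close>, which add up to
  \<open>- \<langle>\<mu>, [\<zeta>\<^sub>1, \<zeta>\<^sub>2]\<rangle>\<close>. The derivative relative to \<open>SO(3) \<times> U\<close> is determined on tangent vectors because each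
  of them is the velocity of a curve inside that set.\<close>

section \<open>The hat map and rotations of unit quaternions\<close>

lemma hat_mult: "hat v *v w = cross3 v w"
  unfolding hat_def using bilinear_cross
  by (simp add: bilinear_def matrix_works)

lemma hat_nth:
  "hat v $ 1 $ 1 = 0" "hat v $ 1 $ 2 = - v $ 3" "hat v $ 1 $ 3 = v $ 2"
  "hat v $ 2 $ 1 = v $ 3" "hat v $ 2 $ 2 = 0" "hat v $ 2 $ 3 = - v $ 1"
  "hat v $ 3 $ 1 = - v $ 2" "hat v $ 3 $ 2 = v $ 1" "hat v $ 3 $ 3 = 0"
  by (simp_all add: hat_def matrix_def cross_components axis_def)

lemma linear_hat: "linear hat"
  by (rule linearI) (simp_all add: vec_eq_iff forall_3 hat_nth)

lemma inj_hat: "inj hat"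
proof (rule injI)
  fix v w assume "hat v = hat w"
  then have "hat v $ i $ j = hat w $ i $ j" for i j by simp
  from this[of 3 2] this[of 1 3] this[of 2 1] show "v = w"
    by (simp add: hat_nth vec_eq_iff forall_3)
qed

lemma vee_hat [simp]: "vee (hat v) = v"
  by (simp add: vee_def inj_hat)

text \<open>These turn a matrix identity into polynomial identities between entries.\<close>

lemmas M3_simps = vec_eq_iff forall_3 hat_nth matrix_matrix_mult_def sum_3 mat_def cross_components
  transpose_def

text \<open>For \<open>a\<^sup>2 + \<bar>b\<bar>\<^sup>2 = 1\<close>, the rotation given by the unit quaternion with real part \<open>a\<close> and
  imaginary part \<open>b\<close>.\<close>
definition quat_rot :: "real \<Rightarrow> R3 \<Rightarrow> M3" where
  "quat_rot a b = mat 1 + (2 * a) *\<^sub>R hat b + 2 *\<^sub>R (hat b ** hat b)"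

lemma transpose_hat: "transpose (hat v) = hat (- v)"
  by (simp add: M3_simps)

lemma transpose_quat_rot: "transpose (quat_rot a b) = quat_rot a (- b)"
  by (simp add: M3_simps quat_rot_def)

text \<open>Cayley-Hamilton: the characteristic polynomial of \<open>hat b\<close> is x^3 + (b
  \<bullet> b) x.\<close>

lemma hat_cubed: "hat b ** hat b ** hat b = - ((b \<bullet> b) *\<^sub>R hat b)"
  by (simp add: M3_simps inner_vec_def algebra_simps)

lemma quat_rot_mult_transpose:
  assumes "a\<^sup>2 + b \<bullet> b = 1"
  shows "quat_rot a b ** quat_rot a (- b) = mat 1"
proof -
  \<comment> \<open>A polynomial identity in free \<open>a\<close> and \<open>b\<close>: the defect
    is written as an explicit multiple of the constraint, so the entries can be compared by pure
    algebra. The determinant and the derivative below are treated the same way.\<close>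
  have "quat_rot a b ** quat_rot a (- b) = mat 1 + (4 * (1 - (a\<^sup>2 + b \<bullet> b))) *\<^sub>R (hat b ** hat b)"
    unfolding quat_rot_def
    by (simp add: M3_simps inner_vec_def power2_eq_square algebra_simps)
  with assms show ?thesis by simp
qed

lemma det_quat_rot:
  assumes "a\<^sup>2 + b \<bullet> b = 1"
  shows "det (quat_rot a b) = 1"
proof -
  have "det (quat_rot a b) = 1 - 4 * (b \<bullet> b) * (1 - (a\<^sup>2 + b \<bullet> b))"
    unfolding quat_rot_def
    by (simp add: M3_simps inner_vec_def det_3 power2_eq_square algebra_simps)
  with assms show ?thesis by simp
qed

text \<open>For a unit quaternion q = (a, b) with velocity q' = (a', b') tangent to the sphere,
  conj(q) q' has real part a a' + b \<bullet> b' = 0 and imaginary part a b' - a' b - b \<times> b'.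
  The factor 2 is that of the double cover of the rotation group.\<close>

lemma quat_rot_deriv_eq:
  assumes "a\<^sup>2 + b \<bullet> b = 1" "a * a' + b \<bullet> b' = 0"
  shows "(2 * a') *\<^sub>R hat b + (2 * a) *\<^sub>R hat b' + 2 *\<^sub>R (hat b ** hat b' + hat b' ** hat b)
    = quat_rot a b ** hat (2 *\<^sub>R (a *\<^sub>R b' - a' *\<^sub>R b - cross3 b b'))"
proof -
  have "(2 * a') *\<^sub>R hat b + (2 * a) *\<^sub>R hat b' + 2 *\<^sub>R (hat b ** hat b' + hat b' ** hat b)
    = quat_rot a b ** hat (2 *\<^sub>R (a *\<^sub>R b' - a' *\<^sub>R b - cross3 b b'))
      + (4 * (1 - (a\<^sup>2 + b \<bullet> b))) *\<^sub>R (hat b ** hat b' + a' *\<^sub>R hat b)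
      + (4 * (a * a' + b \<bullet> b')) *\<^sub>R (hat b ** hat b + a *\<^sub>R hat b)"
    unfolding quat_rot_def
    by (simp add: M3_simps inner_vec_def power2_eq_square algebra_simps)
  with assms show ?thesis by simp
qed

lemma quat_rot_SO3:
  assumes "a\<^sup>2 + b \<bullet> b = 1"
  shows "quat_rot a b \<in> SO3"
  using quat_rot_mult_transpose[of a "- b"] det_quat_rot[OF assms] assms
  by (simp add: SO3_def rotation_matrix_def orthogonal_matrix transpose_quat_rot)

section \<open>The rotation group and its adjoint and coadjoint actions\<close>

lemma SO3_transpose:
  assumes "g \<in> SO3"
  shows "transpose g ** g = mat 1" "g ** transpose g = mat 1" "transpose g \<in> SO3"
  using assms by (auto simp: SO3_def rotation_matrix_def orthogonal_matrix_def)

lemma SO3_mult: "g \<in> SO3 \<Longrightarrow> h \<in> SO3 \<Longrightarrow> g ** h \<in> SO3"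
  by (simp add: SO3_def rotation_matrix_def orthogonal_matrix_mul det_mul)

lemma SO3_matrix_inv:
  assumes "g \<in> SO3"
  shows "matrix_inv g = transpose g"
proof -
  have "g ** matrix_inv g = mat 1"
    unfolding matrix_inv_def
    by (rule someI2[of _ "transpose g"]) (use SO3_transpose[OF assms] in auto)
  then have "(transpose g ** g) ** matrix_inv g = transpose g"
    by (simp add: matrix_mul_assoc[symmetric])
  then show ?thesis
    by (simp add: SO3_transpose[OF assms])
qed

text \<open>Applied to a vector, both sides agree because a rotation preserves the cross
  product.\<close>

lemma SO3_conj_hat:
  assumes "g \<in> SO3"
  shows "g ** hat v ** transpose g = hat (g *v v)"
proof -
  have "g ** hat v ** transpose g *v w = hat (g *v v) *v w" for w
  proof -
    have "g *v (cross3 v (transpose g *v w)) = cross3 (g *v v) (g *v (transpose g *v w))"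
      using assms cross_rotation_matrix[of g] by (simp add: SO3_def)
    then show ?thesis
      by (simp only: matrix_vector_mul_assoc[symmetric] hat_mult)
        (simp only: matrix_vector_mul_assoc SO3_transpose[OF assms] matrix_vector_mul_lid)
  qed
  then show ?thesis by (simp add: matrix_eq)
qed

lemma Ad_SO3:
  assumes "g \<in> SO3"
  shows "Ad g v = g *v v"
  by (simp add: Ad_def SO3_matrix_inv SO3_conj_hat assms)

lemma Ad_star_SO3:
  assumes "g \<in> SO3"
  shows "Ad_star g v = transpose g *v v"
proof -
  have "Ad g = (*v) g" using Ad_SO3[OF assms] by blast
  then show ?thesis by (simp add: Ad_star_def adjoint_matrix)
qed

section \<open>Bilinearity of matrix products and the exponential\<close>

lemma scaleR_matrix_mult_left: "(c *\<^sub>R A) ** B = c *\<^sub>R (A ** B)" for A :: "real^'n^'m" and B :: "real^'p^'n"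
  by (simp add: vec_eq_iff matrix_matrix_mult_def sum_distrib_left mult.assoc)

lemma scaleR_matrix_mult_right: "A ** (c *\<^sub>R B) = c *\<^sub>R (A ** B)" for A :: "real^'n^'m" and B :: "real^'p^'n"
  by (simp add: vec_eq_iff matrix_matrix_mult_def sum_distrib_left mult.left_commute)

lemma matrix_add_right_distrib: "(A + B) ** C = A ** C + B ** C" for A B :: "real^'n^'m" and C :: "real^'p^'n"
  by (simp add: vec_eq_iff matrix_matrix_mult_def sum.distrib algebra_simps)

lemma bounded_bilinear_matrix_mult: "bounded_bilinear ((**) :: real^'n^'m \<Rightarrow> real^'p^'n \<Rightarrow> real^'p^'m)"
  by (subst bilinear_conv_bounded_bilinear[symmetric])
    (auto simp: bilinear_def matrix_add_ldistrib matrix_add_right_distrib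
        scaleR_matrix_mult_left scaleR_matrix_mult_right intro!: linearI)

lemma bounded_bilinear_matrix_vector_mult: "bounded_bilinear ((*v) :: real^'n^'m \<Rightarrow> real^'n \<Rightarrow> real^'m)"
  by (subst bilinear_conv_bounded_bilinear[symmetric])
    (auto simp: bilinear_def scaleR_matrix_vector_assoc matrix_vector_mult_scaleR
      intro!: linearI matrix_vector_right_distrib matrix_vector_mult_add_rdistrib)

text \<open>Rodrigues' formula. Since K^3 = -K for a unit axis, the powers of K reduce to K and K^2,
  and the exponential series splits into the sine and cosine series.\<close>

lemma mat_exp_hat:
  fixes n :: R3
  assumes "norm n = 1"
  shows "mat_exp (hat (\<theta> *\<^sub>R n)) = mat 1 + sin \<theta> *\<^sub>R hat n + (1 - cos \<theta>) *\<^sub>R (hat n ** hat n)"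
proof -
  define K where "K = hat n"
  interpret mm: bounded_bilinear "(**) :: M3 \<Rightarrow> M3 \<Rightarrow> M3"
    by (rule bounded_bilinear_matrix_mult)
  have hat_scale: "hat (\<theta> *\<^sub>R n) = \<theta> *\<^sub>R K"
    by (simp add: K_def linear_cmul[OF linear_hat])
  have "n \<bullet> n = 1" using assms by (simp add: dot_square_norm)
  then have K3: "K ** (K ** K) = - K"
    using hat_cubed[of n] by (simp add: K_def matrix_mul_assoc)
  \<comment> \<open>Closed form of the k-th term of the series. The extra summand at k = 0 makes
    \<open>t 0\<close> the identity, and K annihilates it, so the recursion holds from k = 0
    on.\<close>
  define t where "t k = (if k = 0 then mat 1 + K ** K else 0)
      + (sin_coeff k * \<theta> ^ k) *\<^sub>R K - (cos_coeff k * \<theta> ^ k) *\<^sub>R (K ** K)" for k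
  have step: "(1 / real (Suc k)) *\<^sub>R ((\<theta> *\<^sub>R K) ** t k) = t (Suc k)" for k
  proof -
    have "(\<theta> *\<^sub>R K) ** t k = (cos_coeff k * \<theta> ^ Suc k) *\<^sub>R K + (sin_coeff k * \<theta> ^ Suc k) *\<^sub>R (K ** K)"
      by (simp add: t_def mm.add_right mm.diff_right mm.scaleR_left mm.scaleR_right K3 algebra_simps)
    then show ?thesis
      by (simp add: t_def sin_coeff_Suc cos_coeff_Suc scaleR_add_right)
  qed
  have terms: "(1 / fact k) *\<^sub>R ((((**) (\<theta> *\<^sub>R K)) ^^ k) (mat 1)) = t k" for k
  proof (induction k)
    case 0
    show ?case by (simp add: t_def)
  next
    case (Suc k)
    have "(1 / fact (Suc k)) *\<^sub>R ((((**) (\<theta> *\<^sub>R K)) ^^ Suc k) (mat 1))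
      = (1 / real (Suc k)) *\<^sub>R ((\<theta> *\<^sub>R K) ** ((1 / fact k) *\<^sub>R ((((**) (\<theta> *\<^sub>R K)) ^^ k) (mat 1))))"
      by (simp add: mm.scaleR_right field_simps)
    then show ?case by (simp only: Suc.IH step)
  qed
  have "t sums (mat 1 + K ** K + sin \<theta> *\<^sub>R K - cos \<theta> *\<^sub>R (K ** K))"
    unfolding t_def
    using sums_single[of 0 "\<lambda>_. mat 1 + K ** K"] sin_converges[of \<theta>] cos_converges[of \<theta>]
    by (intro sums_add sums_diff bounded_linear.sums[OF bounded_linear_scaleR_left]) auto
  then have "suminf t = mat 1 + K ** K + sin \<theta> *\<^sub>R K - cos \<theta> *\<^sub>R (K ** K)"
    by (simp add: sums_iff)
  then show ?thesis
    unfolding mat_exp_def hat_scale terms K_def[symmetric]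
    by (simp add: algebra_simps)
qed

section \<open>Rotations parametrised by the open unit ball\<close>

definition ball_rot :: "R3 \<Rightarrow> M3" where
  "ball_rot b = quat_rot (sqrt (1 - b \<bullet> b)) b"

text \<open>The left-trivialised derivative of \<^const>\<open>ball_rot\<close>: twice the imaginary part of \<open>q\<^sup>-\<^sup>1 dq\<close> for the
  unit quaternion \<open>q\<close>.\<close>
definition ball_rot_vel :: "R3 \<Rightarrow> R3 \<Rightarrow> R3" where
  "ball_rot_vel b b' = 2 *\<^sub>R (sqrt (1 - b \<bullet> b) *\<^sub>R b' + ((b \<bullet> b') / sqrt (1 - b \<bullet> b)) *\<^sub>R b - cross3 b b')"

lemma inner_self_less_one: "norm (b :: 'a::real_inner) < 1 \<Longrightarrow> b \<bullet> b < 1"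
  by (simp add: dot_square_norm power_less_one_iff abs_square_less_1)

lemma ball_rot_SO3: "norm b < 1 \<Longrightarrow> ball_rot b \<in> SO3"
  unfolding ball_rot_def using inner_self_less_one[of b] by (intro quat_rot_SO3) simp

lemma ball_rot_0 [simp]: "ball_rot 0 = mat 1"
  by (simp add: ball_rot_def quat_rot_def linear_0[OF linear_hat])

lemma has_derivative_hat [derivative_intros]:
  "(f has_derivative f') F \<Longrightarrow> ((\<lambda>x. hat (f x)) has_derivative (\<lambda>h. hat (f' h))) F"
  using linear_hat bounded_linear.has_derivative linear_conv_bounded_linear by blast

lemma has_derivative_ball_rot:
  assumes b: "(b has_derivative b') (at x within S)" and lt: "norm (b x) < 1"
  shows "((\<lambda>x. ball_rot (b x)) has_derivative
    (\<lambda>h. ball_rot (b x) ** hat (ball_rot_vel (b x) (b' h)))) (at x within S)"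
proof -
  note mm = bounded_bilinear.FDERIV[OF bounded_bilinear_matrix_mult]
  let ?a = "sqrt (1 - b x \<bullet> b x)"
  have pos: "0 < 1 - b x \<bullet> b x" using inner_self_less_one[OF lt] by simp
  have "((\<lambda>x. ball_rot (b x)) has_derivative
    (\<lambda>h. (2 * (- (b x \<bullet> b' h) / ?a)) *\<^sub>R hat (b x) + (2 * ?a) *\<^sub>R hat (b' h)
      + 2 *\<^sub>R (hat (b x) ** hat (b' h) + hat (b' h) ** hat (b x)))) (at x within S)"
    unfolding ball_rot_def quat_rot_def
    using pos
    by (auto intro!: derivative_eq_intros mm b simp: inner_commute field_simps)
  \<comment> \<open>With a' = -(b \<bullet> b') / a, the derivative of the real part, the velocity
    is tangent to the unit sphere, as \<open>quat_rot_deriv_eq\<close> requires.\<close>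
  moreover have "(2 * (- (b x \<bullet> b' h) / ?a)) *\<^sub>R hat (b x) + (2 * ?a) *\<^sub>R hat (b' h)
      + 2 *\<^sub>R (hat (b x) ** hat (b' h) + hat (b' h) ** hat (b x))
    = ball_rot (b x) ** hat (ball_rot_vel (b x) (b' h))" for h
    unfolding ball_rot_def ball_rot_vel_def
    using pos by (subst quat_rot_deriv_eq) auto
  ultimately show ?thesis by simp
qed

text \<open>For the angle 2 arcsin y, sine and one minus cosine are 2 y sqrt(1 - y^2) and 2 y^2, so
  Rodrigues' formula becomes the quaternion formula with imaginary part y n. This form has no
  singularity at \<open>\<eta> = 0\<close>.\<close>

lemma F_rot_eq:
  assumes "r = sqrt (norm \<mu> / norm (\<mu> + \<nu>))" "norm ((r / 2) *\<^sub>R \<eta>) < 1"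
  shows "F_rot \<mu> \<nu> \<eta> = ball_rot ((r / 2) *\<^sub>R \<eta>)"
proof (cases "\<eta> = 0")
  case True
  then show ?thesis by (simp add: F_rot_def)
next
  case False
  define y where "y = 1/2 * norm \<eta> * r"
  define n where "n = \<eta> /\<^sub>R norm \<eta>"
  have n: "norm n = 1" using False by (simp add: n_def)
  have r0: "0 \<le> r" by (simp add: assms)
  then have y: "0 \<le> y" "y < 1" using assms(2) by (simp_all add: y_def field_simps)
  have yn: "(r / 2) *\<^sub>R \<eta> = y *\<^sub>R n" using False by (simp add: y_def n_def)
  have nn: "n \<bullet> n = 1" using n by (simp add: dot_square_norm)
  have s: "sin (2 * arcsin y) = 2 * y * sqrt (1 - y\<^sup>2)"
    using y by (simp add: sin_double cos_arcsin)
  have c: "1 - cos (2 * arcsin y) = 2 * y\<^sup>2"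
    using y by (simp add: cos_double_sin)
  have "F_rot \<mu> \<nu> \<eta> = mat_exp (hat ((2 * arcsin y) *\<^sub>R n))"
    using False by (simp add: F_rot_def y_def n_def assms(1))
  also have "\<dots> = ball_rot (y *\<^sub>R n)"
    unfolding mat_exp_hat[OF n] s c ball_rot_def quat_rot_def
    by (simp add: linear_cmul[OF linear_hat] nn power2_eq_square
        bounded_bilinear.scaleR_left[OF bounded_bilinear_matrix_mult]
        bounded_bilinear.scaleR_right[OF bounded_bilinear_matrix_mult] mult_ac)
  finally show ?thesis by (simp add: yn)
qed

section \<open>Derivatives relative to a set\<close>

text \<open>By the chain rule both values are the velocity of \<open>f \<circ> c\<close> at 0. This
  pins down \<open>frechet_derivative\<close>, a mere choice among the relative derivatives, on
  velocities of curves in the set.\<close>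

lemma has_derivative_within_unique_curve:
  fixes f :: "'a::real_normed_vector \<Rightarrow> 'b::real_normed_vector"
  assumes f1: "(f has_derivative D1) (at p within S)" and f2: "(f has_derivative D2) (at p within S)"
    and c: "(c has_vector_derivative v) (at (0::real))" and c0: "c 0 = p"
    and ev: "eventually (\<lambda>t. c t \<in> S) (nhds 0)"
  shows "D1 v = D2 v"
proof -
  obtain T where T: "open T" "0 \<in> T" "\<And>t. t \<in> T \<Longrightarrow> c t \<in> S"
    using ev by (auto simp: eventually_nhds)
  have cT: "(c has_vector_derivative v) (at 0 within T)"
    using c has_vector_derivative_at_within by blast
  have "(f \<circ> c has_vector_derivative D v) (at 0)"
    if "(f has_derivative D) (at p within S)" for D
  proof -
    have "(f has_derivative D) (at (c 0) within c ` T)"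
      using that T c0 by (auto elim!: has_derivative_subset)
    with cT have "(f \<circ> c has_vector_derivative D v) (at 0 within T)"
      by (rule vector_derivative_diff_chain_within)
    then show ?thesis by (simp only: at_within_open[OF T(2,1)])
  qed
  from this[OF f1] this[OF f2] show ?thesis
    by (rule vector_derivative_unique_at)
qed

section \<open>Isotropy algebra, its complement and the orbit tangent space\<close>

lemma ad_star_eq: "ad_star \<eta> \<mu> = cross3 \<mu> \<eta>"
proof -
  have "ad_star \<eta> \<mu> = transpose (hat \<eta>) *v \<mu>"
    by (simp add: ad_star_def flip: adjoint_matrix) (simp add: hat_mult)
  then show ?thesis
    by (metis transpose_hat hat_mult cross_minus_left cross_skew)
qed

lemma cross3_cross3_orthogonal:
  "\<mu> \<bullet> \<eta> = 0 \<Longrightarrow> cross3 (cross3 \<mu> \<eta>) \<mu> = (\<mu> \<bullet> \<mu>) *\<^sub>R \<eta>"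
  using Lagrange[of \<mu> \<mu> \<eta>] cross_skew[of "cross3 \<mu> \<eta>" \<mu>] by simp

lemma cross3_eq_0_iff_span:
  assumes "\<mu> \<noteq> 0"
  shows "cross3 \<mu> \<xi> = 0 \<longleftrightarrow> (\<exists>k. \<xi> = k *\<^sub>R \<mu>)"
proof
  assume "cross3 \<mu> \<xi> = 0"
  then have "(\<mu> \<bullet> \<xi>) *\<^sub>R \<mu> - (\<mu> \<bullet> \<mu>) *\<^sub>R \<xi> = 0"
    using Lagrange[of \<mu> \<mu> \<xi>] by simp
  then have "(\<mu> \<bullet> \<xi>) *\<^sub>R \<mu> = (\<mu> \<bullet> \<mu>) *\<^sub>R \<xi>" by simp
  then have "inverse (\<mu> \<bullet> \<mu>) *\<^sub>R ((\<mu> \<bullet> \<xi>) *\<^sub>R \<mu>) = \<xi>"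
    using assms by simp
  then have "\<xi> = ((\<mu> \<bullet> \<xi>) / (\<mu> \<bullet> \<mu>)) *\<^sub>R \<mu>"
    by (simp add: field_simps)
  then show "\<exists>k. \<xi> = k *\<^sub>R \<mu>" by blast
qed (auto simp: cross_mult_right)

context
  fixes \<mu> :: R3
  assumes \<mu>: "\<mu> \<noteq> 0"
begin

lemma mem_isotropy: "\<xi> \<in> isotropy \<mu> \<longleftrightarrow> (\<exists>k. \<xi> = k *\<^sub>R \<mu>)"
  by (simp add: isotropy_def ad_star_eq cross3_eq_0_iff_span \<mu>)

lemma mem_isotropy_perp: "\<xi> \<in> isotropy_perp \<mu> \<longleftrightarrow> \<mu> \<bullet> \<xi> = 0"
proof -
  have "\<mu> \<in> isotropy \<mu>" using mem_isotropy[of \<mu>] by (metis scaleR_one)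
  then show ?thesis
    by (auto simp: isotropy_perp_def orthogonal_comp_def orthogonal_def mem_isotropy)
qed

lemma mem_isotropy_dual: "\<nu> \<in> isotropy_dual \<mu> \<longleftrightarrow> (\<exists>k. \<nu> = k *\<^sub>R \<mu>)"
proof
  assume *: "\<nu> \<in> isotropy_dual \<mu>"
  \<comment> \<open>The part of \<open>\<nu>\<close> orthogonal to \<open>\<mu>\<close>. It lies in
    \<open>isotropy_perp \<mu>\<close>, hence pairs to zero with \<open>\<nu>\<close> and so with
    itself.\<close>
  define \<xi> where "\<xi> = \<nu> - ((\<mu> \<bullet> \<nu>) / (\<mu> \<bullet> \<mu>)) *\<^sub>R \<mu>"
  have "\<mu> \<bullet> \<xi> = 0" using \<mu> by (simp add: \<xi>_def inner_diff_right)
  then have "\<nu> \<bullet> \<xi> = 0" using * by (simp add: isotropy_dual_def mem_isotropy_perp)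
  with \<open>\<mu> \<bullet> \<xi> = 0\<close> have "\<xi> \<bullet> \<xi> = 0"
    by (subst (1) \<xi>_def) (simp add: inner_diff_left)
  then have "\<nu> = ((\<mu> \<bullet> \<nu>) / (\<mu> \<bullet> \<mu>)) *\<^sub>R \<mu>" by (simp add: \<xi>_def)
  then show "\<exists>k. \<nu> = k *\<^sub>R \<mu>" by blast
qed (auto simp: isotropy_dual_def mem_isotropy_perp)

text \<open>Explicit inverse of \<open>\<eta> \<mapsto> ad_star \<eta> \<mu>\<close> on the plane
  orthogonal to \<open>\<mu>\<close>. Unlike \<open>orbit_gen\<close> it is linear on the whole
  ambient space.\<close>

definition gen :: "R3 \<Rightarrow> R3" where
  "gen \<rho> = cross3 \<rho> \<mu> /\<^sub>R (\<mu> \<bullet> \<mu>)"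

lemma inner_gen [simp]: "\<mu> \<bullet> gen \<rho> = 0" "gen \<rho> \<bullet> \<mu> = 0"
  by (simp_all add: gen_def dot_cross_self)

lemma cross3_gen: "\<mu> \<bullet> \<rho> = 0 \<Longrightarrow> cross3 \<mu> (gen \<rho>) = \<rho>"
  using \<mu> by (simp add: gen_def cross_mult_right Lagrange)

lemma gen_cross3: "\<mu> \<bullet> \<eta> = 0 \<Longrightarrow> gen (cross3 \<mu> \<eta>) = \<eta>"
  using \<mu> by (simp add: gen_def cross3_cross3_orthogonal)

lemma mem_tangent_orbit: "\<rho> \<in> tangent_orbit \<mu> \<longleftrightarrow> \<mu> \<bullet> \<rho> = 0"
  unfolding tangent_orbit_def mem_Collect_eq mem_isotropy_perp ad_star_eq
  by (metis cross3_gen inner_gen(1) dot_cross_self(1))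

lemma orbit_gen_eq:
  assumes "\<mu> \<bullet> \<rho> = 0"
  shows "orbit_gen \<mu> \<rho> = gen \<rho>"
proof -
  have "inj_on (\<lambda>\<eta>. ad_star \<eta> \<mu>) (isotropy_perp \<mu>)"
    by (rule inj_on_inverseI[of _ gen]) (simp add: mem_isotropy_perp ad_star_eq gen_cross3)
  then have "orbit_gen \<mu> (ad_star (gen \<rho>) \<mu>) = gen \<rho>"
    unfolding orbit_gen_def by (rule inv_into_f_f) (simp add: mem_isotropy_perp)
  then show ?thesis by (simp add: ad_star_eq cross3_gen assms)
qed

lemma isotropy_part_eq: "isotropy_part \<mu> \<xi> = ((\<mu> \<bullet> \<xi>) / (\<mu> \<bullet> \<mu>)) *\<^sub>R \<mu>"
  unfolding isotropy_part_def mem_isotropy mem_isotropy_perp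
  using \<mu> by (intro the_equality) (auto simp: inner_diff_right)

lemma dual_coord_eq: "dual_coord \<mu> (k *\<^sub>R \<mu>) = k * norm \<mu>"
  unfolding dual_coord_def using \<mu> by (intro the_equality) auto

section \<open>The domain and a smooth extension of the map\<close>

text \<open>On \<^term>\<open>isotropy_dual \<mu>\<close> the number \<open>\<kappa>\<close> with \<open>\<mu> + \<nu> = \<kappa> \<mu>\<close>, hence \<open>\<parallel>\<mu> + \<nu>\<parallel> / \<parallel>\<mu>\<parallel>\<close> when it is
  positive, in a form that is smooth on the ambient space.\<close>
definition scale :: "R3 \<Rightarrow> real" where
  "scale \<nu> = ((\<mu> + \<nu>) \<bullet> \<mu>) / (\<mu> \<bullet> \<mu>)"

lemma scale_scaleR: "scale (k *\<^sub>R \<mu>) = 1 + k"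
  using \<mu> by (simp add: scale_def inner_add_left add_divide_distrib)

definition quat_part :: "R3 \<Rightarrow> R3 \<Rightarrow> R3" where
  "quat_part \<nu> \<rho> = (1 / (2 * sqrt (scale \<nu>))) *\<^sub>R gen \<rho>"

text \<open>With \<open>\<mu> + \<nu> = \<kappa> \<mu>\<close>, the bound on \<open>\<nu>\<close>
  says \<kappa> > 0, and the bound on \<open>\<eta>\<close> says that the quaternion has imaginary
  part in the open unit ball.\<close>

lemma mem_U_dom:
  "(\<nu>, \<rho>) \<in> U_dom \<mu> \<longleftrightarrow>
    \<nu> \<in> isotropy_dual \<mu> \<and> \<mu> \<bullet> \<rho> = 0 \<and> 0 < scale \<nu> \<and> norm (quat_part \<nu> \<rho>) < 1"
proof -
  have *: "(dual_coord \<mu> \<nu> > - norm \<mu> \<and> norm \<eta> < 2 * sqrt (norm (\<mu> + \<nu>) / norm \<mu>))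
    \<longleftrightarrow> (0 < scale \<nu> \<and> norm (quat_part \<nu> (cross3 \<mu> \<eta>)) < 1)"
    if \<nu>: "\<nu> \<in> isotropy_dual \<mu>" and \<eta>: "\<mu> \<bullet> \<eta> = 0" for \<eta>
  proof -
    obtain k where k: "\<nu> = k *\<^sub>R \<mu>" using \<nu> mem_isotropy_dual by blast
    have "\<mu> + \<nu> = (1 + k) *\<^sub>R \<mu>" by (simp add: k algebra_simps)
    then have n: "norm (\<mu> + \<nu>) / norm \<mu> = \<bar>1 + k\<bar>" using \<mu> by simp
    have "- norm \<mu> < dual_coord \<mu> \<nu> \<longleftrightarrow> 0 < (1 + k) * norm \<mu>"
      unfolding k dual_coord_eq distrib_right by linarith
    also have "\<dots> \<longleftrightarrow> 0 < 1 + k" using \<mu> by (simp add: zero_less_mult_iff)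
    finally show ?thesis
      using \<eta> unfolding n
      by (auto simp: k scale_scaleR quat_part_def gen_cross3 field_simps)
  qed
  have "(\<nu>, \<rho>) \<in> U_dom \<mu> \<longleftrightarrow> \<nu> \<in> isotropy_dual \<mu> \<and> (\<exists>\<eta>. \<rho> = cross3 \<mu> \<eta> \<and> \<mu> \<bullet> \<eta> = 0 \<and>
      dual_coord \<mu> \<nu> > - norm \<mu> \<and> norm \<eta> < 2 * sqrt (norm (\<mu> + \<nu>) / norm \<mu>))"
    by (auto simp: U_dom_def mem_isotropy_perp ad_star_eq)
  also have "\<dots> \<longleftrightarrow> \<nu> \<in> isotropy_dual \<mu> \<and> (\<exists>\<eta>. \<rho> = cross3 \<mu> \<eta> \<and> \<mu> \<bullet> \<eta> = 0 \<and>
      0 < scale \<nu> \<and> norm (quat_part \<nu> \<rho>) < 1)"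
    using * by blast
  also have "\<dots> \<longleftrightarrow> \<nu> \<in> isotropy_dual \<mu> \<and> \<mu> \<bullet> \<rho> = 0 \<and> 0 < scale \<nu> \<and> norm (quat_part \<nu> \<rho>) < 1"
    by (metis cross3_gen inner_gen(1) dot_cross_self(1))
  finally show ?thesis .
qed

text \<open>Agrees with \<open>\<Phi> \<mu>\<close> on the domain and is differentiable in the
  ambient space at each of its points, so ordinary derivative rules apply.\<close>

definition \<Phi>_ext :: "M3 \<times> R3 \<times> R3 \<Rightarrow> M3 \<times> R3" where
  "\<Phi>_ext = (\<lambda>p. let Q = ball_rot (quat_part (fst (snd p)) (snd (snd p))) in
     (fst p ** transpose Q, Q *v (\<mu> + fst (snd p))))"

lemma \<Phi>_eq_ext:
  assumes "p \<in> SO3 \<times> U_dom \<mu>"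
  shows "\<Phi> \<mu> p = \<Phi>_ext p"
proof -
  obtain g \<nu> \<rho> where p: "p = (g, \<nu>, \<rho>)" by (metis surj_pair)
  have g: "g \<in> SO3" and U: "\<nu> \<in> isotropy_dual \<mu>" "\<mu> \<bullet> \<rho> = 0" "0 < scale \<nu>" "norm (quat_part \<nu> \<rho>) < 1"
    using assms by (auto simp: p mem_U_dom)
  obtain k where k: "\<nu> = k *\<^sub>R \<mu>" using U mem_isotropy_dual by blast
  have k0: "0 < 1 + k" using U by (simp add: k scale_scaleR)
  have "\<mu> + \<nu> = (1 + k) *\<^sub>R \<mu>" by (simp add: k algebra_simps)
  then have "sqrt (norm \<mu> / norm (\<mu> + \<nu>)) = 1 / sqrt (scale \<nu>)"
    using \<mu> k0 by (simp add: k scale_scaleR real_sqrt_divide)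
  then have F: "F_rot \<mu> \<nu> (gen \<rho>) = ball_rot (quat_part \<nu> \<rho>)"
    using F_rot_eq[OF refl, of \<mu> \<nu> "gen \<rho>"] U(4) by (simp add: quat_part_def field_simps)
  have Q: "ball_rot (quat_part \<nu> \<rho>) \<in> SO3" using U(4) by (rule ball_rot_SO3)
  show ?thesis
    by (simp add: \<Phi>_def \<Phi>_ext_def p orbit_gen_eq U(2) F SO3_matrix_inv[OF Q]
        Ad_star_SO3[OF SO3_transpose(3)[OF Q]] Let_def del: transpose_matrix_vector)
qed

section \<open>The derivative of the map\<close>

definition scale_deriv :: "R3 \<Rightarrow> real" where
  "scale_deriv n = (n \<bullet> \<mu>) / (\<mu> \<bullet> \<mu>)"

text \<open>The subtracted term comes from differentiating \<kappa>^(-1/2).\<close>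

definition quat_deriv :: "R3 \<Rightarrow> R3 \<Rightarrow> R3 \<Rightarrow> R3 \<Rightarrow> R3" where
  "quat_deriv \<nu> \<rho> n s = (1 / (2 * sqrt (scale \<nu>))) *\<^sub>R (gen s - (scale_deriv n / (2 * scale \<nu>)) *\<^sub>R gen \<rho>)"

lemma has_derivative_gen: 
  "(f has_derivative f') F \<Longrightarrow> ((\<lambda>x. gen (f x)) has_derivative (\<lambda>h. gen (f' h))) F"
proof -
  have "linear gen"
    by (rule linearI) (simp_all add: gen_def cross_add_left cross_mult_left algebra_simps)
  then show "(f has_derivative f') F \<Longrightarrow> ((\<lambda>x. gen (f x)) has_derivative (\<lambda>h. gen (f' h))) F"
    using bounded_linear.has_derivative linear_conv_bounded_linear by blast
qed

lemma has_derivative_quat_part: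
  assumes "0 < scale \<nu>"
  shows "((\<lambda>p. quat_part (fst (snd p)) (snd (snd p))) has_derivative
    (\<lambda>h. quat_deriv \<nu> \<rho> (fst (snd h)) (snd (snd h)))) (at (g :: M3, \<nu>, \<rho>))"
proof -
  have d: "((\<lambda>p. scale (fst (snd p))) has_derivative (\<lambda>h. scale_deriv (fst (snd h)))) (at (g :: M3, \<nu>, \<rho>))"
    unfolding scale_def scale_deriv_def using \<mu> by (auto intro!: derivative_eq_intros)
  have e: "((\<lambda>p. gen (snd (snd p))) has_derivative (\<lambda>h. gen (snd (snd h)))) (at (g :: M3, \<nu>, \<rho>))"
    by (auto intro!: derivative_eq_intros has_derivative_gen)
  show ?thesis
    unfolding quat_part_def quat_deriv_def
    apply (rule has_derivative_eq_rhs)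
     apply (rule has_derivative_scaleR[OF _ e])
     apply (rule has_derivative_divide[OF has_derivative_const])
      apply (rule has_derivative_mult[OF has_derivative_const])
      apply (rule has_derivative_real_sqrt[OF _ d])
    using assms by (auto simp: fun_eq_iff field_simps scaleR_diff_right)
qed

text \<open>The minus sign arises from transposing \<open>Q ** hat A\<close>, as
  \<open>hat A\<close> is skew.\<close>

definition \<Phi>' where
  "\<Phi>' g \<nu> \<rho> h = (let b = quat_part \<nu> \<rho>; Q = ball_rot b;
       A = ball_rot_vel b (quat_deriv \<nu> \<rho> (fst (snd h)) (snd (snd h))) in
     (fst h ** transpose Q - g ** hat A ** transpose Q,
      Q *v (cross3 A (\<mu> + \<nu>) + fst (snd h))))"

lemma has_derivative_\<Phi>_ext:
  assumes "0 < scale \<nu>" "norm (quat_part \<nu> \<rho>) < 1"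
  shows "(\<Phi>_ext has_derivative \<Phi>' g \<nu> \<rho>) (at (g, \<nu>, \<rho>))"
proof -
  let ?Q = "\<lambda>p. ball_rot (quat_part (fst (snd p)) (snd (snd p)))"
  let ?A = "\<lambda>h. ball_rot_vel (quat_part \<nu> \<rho>) (quat_deriv \<nu> \<rho> (fst (snd h)) (snd (snd h)))"
  have Q: "(?Q has_derivative (\<lambda>h. ?Q (g, \<nu>, \<rho>) ** hat (?A h))) (at (g, \<nu>, \<rho>))"
    using has_derivative_ball_rot[OF has_derivative_quat_part[OF assms(1), of \<rho> g]] assms(2) by simp
  have "linear (transpose :: M3 \<Rightarrow> M3)"
    by (rule linearI) (simp_all add: M3_simps)
  then have "bounded_linear (transpose :: M3 \<Rightarrow> M3)"
    by (simp add: linear_conv_bounded_linear)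
  note T = bounded_linear.has_derivative[OF this Q]
  have 1: "((\<lambda>p. fst p ** transpose (?Q p)) has_derivative
      (\<lambda>h. g ** transpose (?Q (g, \<nu>, \<rho>) ** hat (?A h)) + fst h ** transpose (?Q (g, \<nu>, \<rho>)))) (at (g, \<nu>, \<rho>))"
    using bounded_bilinear.FDERIV[OF bounded_bilinear_matrix_mult _ T, of fst fst]
    by (simp add: has_derivative_fst[OF has_derivative_ident])
  have m: "((\<lambda>p. \<mu> + fst (snd p)) has_derivative (\<lambda>h. fst (snd h))) (at (g, \<nu>, \<rho>))"
    by (auto intro!: derivative_eq_intros)
  have 2: "((\<lambda>p. ?Q p *v (\<mu> + fst (snd p))) has_derivative
      (\<lambda>h. ?Q (g, \<nu>, \<rho>) *v fst (snd h) + (?Q (g, \<nu>, \<rho>) ** hat (?A h)) *v (\<mu> + \<nu>))) (at (g, \<nu>, \<rho>))"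
    using bounded_bilinear.FDERIV[OF bounded_bilinear_matrix_vector_mult Q m] by simp
  have neg: "g ** (hat (- A) ** B) = - (g ** hat A ** B)" for A and B :: M3
    by (simp add: linear_neg[OF linear_hat] matrix_mul_assoc
        bounded_bilinear.minus_left[OF bounded_bilinear_matrix_mult]
        bounded_bilinear.minus_right[OF bounded_bilinear_matrix_mult])
  show ?thesis
    unfolding \<Phi>_ext_def \<Phi>'_def Let_def
    by (rule has_derivative_eq_rhs[OF has_derivative_Pair[OF 1 2]])
      (simp add: fun_eq_iff matrix_transpose_mul transpose_hat neg matrix_vector_mul_assoc[symmetric]
        hat_mult matrix_vector_right_distrib cross_add_right)
qed

lemma has_derivative_\<Phi>:
  assumes "(g, \<nu>, \<rho>) \<in> SO3 \<times> U_dom \<mu>"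
  shows "(\<Phi> \<mu> has_derivative \<Phi>' g \<nu> \<rho>) (at (g, \<nu>, \<rho>) within SO3 \<times> U_dom \<mu>)"
proof (rule has_derivative_transform[OF assms \<Phi>_eq_ext])
  show "(\<Phi>_ext has_derivative \<Phi>' g \<nu> \<rho>) (at (g, \<nu>, \<rho>) within SO3 \<times> U_dom \<mu>)"
    using assms by (auto simp: mem_U_dom intro: has_derivative_at_withinI[OF has_derivative_\<Phi>_ext])
qed

section \<open>Curves in the domain and the tangent map\<close>

lemma isCont_eventually_less:
  fixes f :: "real \<Rightarrow> real"
  assumes "isCont f x" "f x < a"
  shows "eventually (\<lambda>t. f t < a) (nhds x)"
  using assms tendsto_at_iff_tendsto_nhds[of f x] unfolding isCont_def
  by (auto intro: order_tendstoD(2))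

lemma isCont_eventually_greater:
  fixes f :: "real \<Rightarrow> real"
  assumes "isCont f x" "a < f x"
  shows "eventually (\<lambda>t. a < f t) (nhds x)"
  using assms tendsto_at_iff_tendsto_nhds[of f x] unfolding isCont_def
  by (auto intro: order_tendstoD(1))

text \<open>The derivative of \<open>ball_rot\<close> at 0 is twice \<open>hat\<close>, whence the
  factor 1/2 in the curve. Straight lines suffice in the other components: the constraints on them
  are linear except for two open conditions, which persist for small t.\<close>

lemma curve_through:
  fixes \<xi> :: R3
  assumes g: "g \<in> SO3" and U: "(\<nu>, \<rho>) \<in> U_dom \<mu>"
    and n: "n \<in> isotropy_dual \<mu>" and s: "\<mu> \<bullet> s = 0"
  defines "c \<equiv> \<lambda>t::real. (g ** ball_rot ((t / 2) *\<^sub>R \<xi>), \<nu> + t *\<^sub>R n, \<rho> + t *\<^sub>R s)"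
  shows "(c has_vector_derivative (g ** hat \<xi>, n, s)) (at 0)" "c 0 = (g, \<nu>, \<rho>)"
    "eventually (\<lambda>t. c t \<in> SO3 \<times> U_dom \<mu>) (nhds 0)"
proof -
  have vel: "ball_rot_vel 0 ((h / 2) *\<^sub>R \<xi>) = h *\<^sub>R \<xi>" for h
    by (simp add: ball_rot_vel_def)
  have "((\<lambda>t. ball_rot ((t / 2) *\<^sub>R \<xi>)) has_derivative (\<lambda>h. h *\<^sub>R hat \<xi>)) (at 0)"
    using has_derivative_ball_rot[of "\<lambda>t. (t / 2) *\<^sub>R \<xi>" "\<lambda>h. (h / 2) *\<^sub>R \<xi>" 0 UNIV]
    by (simp add: vel linear_cmul[OF linear_hat] bounded_linear_imp_has_derivative
        bounded_linear_compose[OF bounded_linear_scaleR_left bounded_linear_divide])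
  then have "((\<lambda>t. g ** ball_rot ((t / 2) *\<^sub>R \<xi>)) has_vector_derivative g ** hat \<xi>) (at 0)"
    unfolding has_vector_derivative_def[symmetric]
    by (rule bounded_linear.has_vector_derivative[OF
        bounded_bilinear.bounded_linear_right[OF bounded_bilinear_matrix_mult]])
  moreover have "((\<lambda>t. \<nu> + t *\<^sub>R n) has_vector_derivative n) (at 0)"
    "((\<lambda>t. \<rho> + t *\<^sub>R s) has_vector_derivative s) (at 0)"
    by (auto intro!: derivative_eq_intros simp: has_vector_derivative_def)
  ultimately show deriv: "(c has_vector_derivative (g ** hat \<xi>, n, s)) (at 0)"
    unfolding c_def by (intro has_vector_derivative_Pair)
  show c0: "c 0 = (g, \<nu>, \<rho>)" by (simp add: c_def)
  have U': "\<nu> \<in> isotropy_dual \<mu>" "\<mu> \<bullet> \<rho> = 0" "0 < scale \<nu>" "norm (quat_part \<nu> \<rho>) < 1"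
    using U by (auto simp: mem_U_dom)
  have c_cont: "isCont c 0"
    using deriv by (rule has_vector_derivative_continuous)
  have "isCont (\<lambda>p. quat_part (fst (snd p)) (snd (snd p))) (c 0)"
    unfolding c0 by (rule has_derivative_continuous[OF has_derivative_quat_part[OF U'(3)]])
  from isCont_o2[OF c_cont this]
  have "isCont (\<lambda>t. norm (quat_part (\<nu> + t *\<^sub>R n) (\<rho> + t *\<^sub>R s))) 0"
    by (simp add: c_def)
  then have "eventually (\<lambda>t. norm (quat_part (\<nu> + t *\<^sub>R n) (\<rho> + t *\<^sub>R s)) < 1) (nhds 0)"
    by (rule isCont_eventually_less) (simp add: U')
  moreover have "isCont (\<lambda>t. scale (\<nu> + t *\<^sub>R n)) 0"
    unfolding scale_def using \<mu> by (intro continuous_intros) auto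
  then have "eventually (\<lambda>t. 0 < scale (\<nu> + t *\<^sub>R n)) (nhds 0)"
    by (rule isCont_eventually_greater) (simp add: U')
  moreover have "isCont (\<lambda>t. norm ((t / 2) *\<^sub>R \<xi>)) 0"
    by (intro continuous_intros) auto
  then have "eventually (\<lambda>t. norm ((t / 2) *\<^sub>R \<xi>) < 1) (nhds 0)"
    by (rule isCont_eventually_less) simp
  ultimately show "eventually (\<lambda>t. c t \<in> SO3 \<times> U_dom \<mu>) (nhds 0)"
  proof eventually_elim
    case (elim t)
    obtain k l where "\<nu> = k *\<^sub>R \<mu>" "n = l *\<^sub>R \<mu>"
      using U'(1) n mem_isotropy_dual by blast
    then have "\<nu> + t *\<^sub>R n = (k + t * l) *\<^sub>R \<mu>" by (simp add: algebra_simps)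
    then have "\<nu> + t *\<^sub>R n \<in> isotropy_dual \<mu>" using mem_isotropy_dual by blast
    then show ?case
      using elim g s U' by (simp add: c_def mem_U_dom SO3_mult ball_rot_SO3 inner_add_right)
  qed
qed

lemma tangent_map_\<Phi>:
  assumes g: "g \<in> SO3" and U: "(\<nu>, \<rho>) \<in> U_dom \<mu>"
    and n: "n \<in> isotropy_dual \<mu>" and s: "\<mu> \<bullet> s = 0"
  defines "Q \<equiv> ball_rot (quat_part \<nu> \<rho>)"
  defines "A \<equiv> ball_rot_vel (quat_part \<nu> \<rho>) (quat_deriv \<nu> \<rho> n s)"
  shows "tangent_map (\<Phi> \<mu>) (SO3 \<times> U_dom \<mu>) (g, \<nu>, \<rho>) (\<xi>, n, s)
    = (Q *v (\<xi> - A), Q *v (cross3 A (\<mu> + \<nu>) + n))"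
proof -
  let ?S = "SO3 \<times> U_dom \<mu>" and ?p = "(g, \<nu>, \<rho>)"
  have S: "?p \<in> ?S" using g U by simp
  note D = has_derivative_\<Phi>[OF S]
  have "(\<Phi> \<mu> has_derivative frechet_derivative (\<Phi> \<mu>) (at ?p within ?S)) (at ?p within ?S)"
    using D by (simp add: differentiableI flip: frechet_derivative_works)
  from has_derivative_within_unique_curve[OF this D curve_through[OF g U n s]]
  have "frechet_derivative (\<Phi> \<mu>) (at ?p within ?S) (g ** hat \<xi>, n, s) = \<Phi>' g \<nu> \<rho> (g ** hat \<xi>, n, s)" .
  also have "\<dots> = (g ** hat (\<xi> - A) ** transpose Q, Q *v (cross3 A (\<mu> + \<nu>) + n))"
    by (simp add: \<Phi>'_def Let_def A_def Q_def linear_diff[OF linear_hat]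
        bounded_bilinear.diff_left[OF bounded_bilinear_matrix_mult]
        bounded_bilinear.diff_right[OF bounded_bilinear_matrix_mult])
  finally have fd: "frechet_derivative (\<Phi> \<mu>) (at ?p within ?S) (g ** hat \<xi>, n, s)
    = (g ** hat (\<xi> - A) ** transpose Q, Q *v (cross3 A (\<mu> + \<nu>) + n))" .
  have Q: "Q \<in> SO3" unfolding Q_def using U by (intro ball_rot_SO3) (simp add: mem_U_dom)
  have gQ: "g ** transpose Q \<in> SO3" using g Q by (simp add: SO3_mult SO3_transpose)
  \<comment> \<open>Left-trivialisation at the image point cancels \<open>g\<close> and leaves a
    conjugation by \<open>Q\<close>.\<close>
  have "matrix_inv (g ** transpose Q) ** (g ** hat (\<xi> - A) ** transpose Q)
    = Q ** (transpose g ** g) ** hat (\<xi> - A) ** transpose Q"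
    by (simp add: SO3_matrix_inv[OF gQ] matrix_transpose_mul matrix_mul_assoc)
  also have "\<dots> = hat (Q *v (\<xi> - A))"
    by (simp add: SO3_transpose(1)[OF g] SO3_conj_hat[OF Q])
  finally have "vee (matrix_inv (g ** transpose Q) ** (g ** hat (\<xi> - A) ** transpose Q)) = Q *v (\<xi> - A)"
    by simp
  then show ?thesis
    using \<Phi>_eq_ext[OF S]
    by (simp add: tangent_map_def from_left_def to_left_def fd \<Phi>_ext_def Let_def flip: Q_def)
qed

section \<open>Comparison of the two symplectic forms\<close>

lemma \<Omega>_c_rotate:
  assumes "Q \<in> SO3"
  shows "\<Omega>_c (h, Q *v m) (Q *v x1, Q *v y1) (Q *v x2, Q *v y2) = \<Omega>_c (h', m) (x1, y1) (x2, y2)"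
proof -
  have "(Q *v x) \<bullet> (Q *v y) = x \<bullet> y" for x y
    using assms orthogonal_transformation_matrix[of "(*v) Q"]
    by (simp add: SO3_def rotation_matrix_def orthogonal_transformation_def)
  moreover have "cross3 (Q *v x) (Q *v y) = Q *v cross3 x y" for x y
    using assms cross_rotation_matrix by (simp add: SO3_def)
  ultimately show ?thesis by (simp add: \<Omega>_c_def)
qed

text \<open>The terms mixing A with \<xi> cancel between the bracket and the pairings; the three
  terms quadratic in A add up to a single one of negative sign.\<close>

lemma \<Omega>_c_shift:
  "\<Omega>_c (h, m) (\<xi>1 - A1, cross3 A1 m + n1) (\<xi>2 - A2, cross3 A2 m + n2)
    = m \<bullet> cross3 \<xi>1 \<xi>2 + n2 \<bullet> \<xi>1 - n1 \<bullet> \<xi>2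
      - (m \<bullet> cross3 A1 A2 + n2 \<bullet> A1 - n1 \<bullet> A2)"
  unfolding \<Omega>_c_def by (simp add: cross3_simps)

lemma inner_ball_rot_vel:
  assumes "\<mu> \<bullet> b = 0" "\<mu> \<bullet> x = 0"
  shows "\<mu> \<bullet> ball_rot_vel b x = - 2 * (\<mu> \<bullet> cross3 b x)"
  using assms by (simp add: ball_rot_vel_def inner_diff_right inner_add_right)

text \<open>In the plane orthogonal to \<open>\<mu>\<close>, b \<times> x and b \<times> y are
  parallel to \<open>\<mu>\<close> and drop out. The remaining terms contribute a^2 and, through
  \<open>planar\<close>, b \<bullet> b, which sum to 1.\<close>

lemma cross3_ball_rot_vel:
  assumes "\<mu> \<bullet> b = 0" "\<mu> \<bullet> x = 0" "\<mu> \<bullet> y = 0" "norm b < 1"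
  shows "\<mu> \<bullet> cross3 (ball_rot_vel b x) (ball_rot_vel b y) = 4 * (\<mu> \<bullet> cross3 x y)"
proof -
  define a where "a = sqrt (1 - b \<bullet> b)"
  have a2: "a * a = 1 - b \<bullet> b" and a0: "a \<noteq> 0"
    using inner_self_less_one[OF assms(4)] by (simp_all add: a_def)
  have par: "\<mu> \<bullet> cross3 u (cross3 b z) = 0" "\<mu> \<bullet> cross3 (cross3 b z) u = 0" if "\<mu> \<bullet> z = 0" for u z
  proof -
    have "\<mu> \<bullet> cross3 u (cross3 b z) = (u \<bullet> z) * (\<mu> \<bullet> b) - (u \<bullet> b) * (\<mu> \<bullet> z)"
      by (simp add: Lagrange inner_diff_right)
    then show "\<mu> \<bullet> cross3 u (cross3 b z) = 0" using that assms by simp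
    then show "\<mu> \<bullet> cross3 (cross3 b z) u = 0" using cross_skew[of "cross3 b z" u] by simp
  qed
  have planar: "(b \<bullet> y) * (\<mu> \<bullet> cross3 x b) + (b \<bullet> x) * (\<mu> \<bullet> cross3 b y) = (b \<bullet> b) * (\<mu> \<bullet> cross3 x y)"
  proof -
    \<comment> \<open>The linear relation between four vectors of three-space, with triple products
      as coefficients, paired with \<open>b\<close>.\<close>
    have "(b \<bullet> y) * (\<mu> \<bullet> cross3 x b) + (b \<bullet> x) * (\<mu> \<bullet> cross3 b y)
      = (b \<bullet> b) * (\<mu> \<bullet> cross3 x y) - (\<mu> \<bullet> b) * (b \<bullet> cross3 x y)"
      by (simp add: cross3_simps)
    then show ?thesis using assms by simp
  qed
  have "\<mu> \<bullet> cross3 (ball_rot_vel b x) (ball_rot_vel b y)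
    = 4 * ((a * a) * (\<mu> \<bullet> cross3 x y) + (a / a) * ((b \<bullet> y) * (\<mu> \<bullet> cross3 x b) + (b \<bullet> x) * (\<mu> \<bullet> cross3 b y)))"
    unfolding ball_rot_vel_def a_def[symmetric]
    by (simp add: cross_mult_left cross_mult_right cross_add_left cross_add_right
        Cross3.left_diff_distrib Cross3.right_diff_distrib inner_add_right inner_diff_right par assms
        algebra_simps)
  also have "\<dots> = 4 * (\<mu> \<bullet> cross3 x y)"
    using a0 unfolding planar a2 by (simp add: algebra_simps)
  finally show ?thesis .
qed

text \<open>In the complement of \<open>\<mu>\<close> this is the identity
  \<open>d (\<onehalf> (\<eta>\<^sub>1 d\<eta>\<^sub>2 - \<eta>\<^sub>2 d\<eta>\<^sub>1)) = d\<eta>\<^sub>1 \<and> d\<eta>\<^sub>2\<close>: since the quaternion is proportional to \<open>\<eta> / \<surd>\<kappa>\<close>, the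
  scale drops out of the one-form \<open>2\<kappa> (b\<^sub>1 db\<^sub>2 - b\<^sub>2 db\<^sub>1)\<close>.\<close>
lemma correction_term:
  fixes s1 s2 :: R3
  assumes k: "\<nu> = k *\<^sub>R \<mu>" "n1 = k1 *\<^sub>R \<mu>" "n2 = k2 *\<^sub>R \<mu>"
    and U: "0 < scale \<nu>" "norm (quat_part \<nu> \<rho>) < 1"
  defines "A1 \<equiv> ball_rot_vel (quat_part \<nu> \<rho>) (quat_deriv \<nu> \<rho> n1 s1)"
    and "A2 \<equiv> ball_rot_vel (quat_part \<nu> \<rho>) (quat_deriv \<nu> \<rho> n2 s2)"
  shows "(\<mu> + \<nu>) \<bullet> cross3 A1 A2 + n2 \<bullet> A1 - n1 \<bullet> A2 = \<mu> \<bullet> cross3 (gen s1) (gen s2)"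
proof -
  define r where "r = 1 / (2 * sqrt (1 + k))"
  define b where "b = r *\<^sub>R gen \<rho>"
  define x where "x l s = r *\<^sub>R (gen s - (l / (2 * (1 + k))) *\<^sub>R gen \<rho>)" for l s
  have k0: "0 < 1 + k" using U by (simp add: k scale_scaleR)
  have r: "r * r = 1 / (4 * (1 + k))" using k0 by (simp add: r_def)
  have b: "quat_part \<nu> \<rho> = b" by (simp add: quat_part_def k scale_scaleR b_def r_def)
  have scale_deriv: "scale_deriv (l *\<^sub>R \<mu>) = l" for l using \<mu> by (simp add: scale_deriv_def)
  have A: "A1 = ball_rot_vel b (x k1 s1)" "A2 = ball_rot_vel b (x k2 s2)"
    unfolding A1_def A2_def b by (simp_all add: quat_deriv_def k scale_scaleR x_def r_def scale_deriv)
  have [simp]: "\<mu> \<bullet> b = 0" "\<mu> \<bullet> x l s = 0" for l s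
    by (simp_all add: b_def x_def inner_diff_right)
  have bx: "\<mu> \<bullet> cross3 b (x l s) = r * r * (\<mu> \<bullet> cross3 (gen \<rho>) (gen s))" for l s
    by (simp add: b_def x_def cross_mult_left cross_mult_right Cross3.right_diff_distrib inner_diff_right)
  have skew: "cross3 (gen s1) (gen \<rho>) = - cross3 (gen \<rho>) (gen s1)" by (rule cross_skew)
  \<comment> \<open>The product of the two \<open>gen \<rho>\<close> terms vanishes, leaving terms
    of first order in \<open>k1\<close> and \<open>k2\<close>.\<close>
  have xx: "\<mu> \<bullet> cross3 (x k1 s1) (x k2 s2) = r * r * (\<mu> \<bullet> cross3 (gen s1) (gen s2)
     + (k2 / (2 * (1 + k))) * (\<mu> \<bullet> cross3 (gen \<rho>) (gen s1))
     - (k1 / (2 * (1 + k))) * (\<mu> \<bullet> cross3 (gen \<rho>) (gen s2)))"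
    unfolding x_def
    by (simp add: cross_mult_left cross_mult_right Cross3.right_diff_distrib Cross3.left_diff_distrib
        inner_diff_right skew algebra_simps)
  have "norm b < 1" using U b by simp
  then have "(\<mu> + \<nu>) \<bullet> cross3 A1 A2 + n2 \<bullet> A1 - n1 \<bullet> A2
    = (1 + k) * (4 * (\<mu> \<bullet> cross3 (x k1 s1) (x k2 s2)))
      - 2 * k2 * (\<mu> \<bullet> cross3 b (x k1 s1)) + 2 * k1 * (\<mu> \<bullet> cross3 b (x k2 s2))"
    by (simp add: A k inner_add_left inner_ball_rot_vel cross3_ball_rot_vel algebra_simps)
  also have "\<dots> = \<mu> \<bullet> cross3 (gen s1) (gen s2)"
  proof -
    \<comment> \<open>Here K = 1 + k. Since r^2 = 1 / (4 K), the prefactor of X is 1, and the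
      \<open>k1\<close> and \<open>k2\<close> terms of the bracket cancel those of the two
      pairings.\<close>
    have "K * (4 * (1 / (4 * K) * (X + k2 / (2 * K) * Y - k1 / (2 * K) * Z)))
        - 2 * k2 * (1 / (4 * K) * Y) + 2 * k1 * (1 / (4 * K) * Z) = X"
      if "0 < K" for K X Y Z :: real
      using that by (simp add: field_simps)
    from this[OF k0] show ?thesis unfolding xx bx r .
  qed
  finally show ?thesis .
qed

lemma pullback_\<Omega>_c:
  assumes g: "g \<in> SO3" and U: "(\<nu>, \<rho>) \<in> U_dom \<mu>"
    and n: "n1 \<in> isotropy_dual \<mu>" "n2 \<in> isotropy_dual \<mu>"
    and s: "\<mu> \<bullet> s1 = 0" "\<mu> \<bullet> s2 = 0"
  shows "pullback_form (\<Phi> \<mu>) (SO3 \<times> U_dom \<mu>) \<Omega>_c (g, \<nu>, \<rho>) (\<xi>1, n1, s1) (\<xi>2, n2, s2)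
    = \<Omega>_Y \<mu> (g, \<nu>, \<rho>) (\<xi>1, n1, s1) (\<xi>2, n2, s2)"
proof -
  have "\<nu> \<in> isotropy_dual \<mu>" using U by (simp add: mem_U_dom)
  then obtain k k1 k2 where k: "\<nu> = k *\<^sub>R \<mu>" "n1 = k1 *\<^sub>R \<mu>" "n2 = k2 *\<^sub>R \<mu>"
    using n unfolding mem_isotropy_dual by blast
  have U': "0 < scale \<nu>" "norm (quat_part \<nu> \<rho>) < 1"
    using U by (auto simp: mem_U_dom)
  \<comment> \<open>Covectors along \<open>\<mu>\<close> see only the isotropy component, so the
    pairings of the two forms agree.\<close>
  have part: "(l *\<^sub>R \<mu>) \<bullet> isotropy_part \<mu> \<xi> = (l *\<^sub>R \<mu>) \<bullet> \<xi>" for l \<xi>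
    using \<mu> by (simp add: isotropy_part_eq)
  have "\<Phi> \<mu> (g, \<nu>, \<rho>) = (g ** transpose (ball_rot (quat_part \<nu> \<rho>)), ball_rot (quat_part \<nu> \<rho>) *v (\<mu> + \<nu>))"
    using g U by (subst \<Phi>_eq_ext) (auto simp: \<Phi>_ext_def Let_def)
  then have "pullback_form (\<Phi> \<mu>) (SO3 \<times> U_dom \<mu>) \<Omega>_c (g, \<nu>, \<rho>) (\<xi>1, n1, s1) (\<xi>2, n2, s2)
    = (\<mu> + \<nu>) \<bullet> cross3 \<xi>1 \<xi>2 + n2 \<bullet> \<xi>1 - n1 \<bullet> \<xi>2 - \<mu> \<bullet> cross3 (gen s1) (gen s2)"
    by (simp only: pullback_form_def tangent_map_\<Phi>[OF g U n(1) s(1)] tangent_map_\<Phi>[OF g U n(2) s(2)]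
        \<Omega>_c_rotate[OF ball_rot_SO3[OF U'(2)], where h' = g] \<Omega>_c_shift correction_term[OF k U'])
  also have "\<dots> = \<Omega>_Y \<mu> (g, \<nu>, \<rho>) (\<xi>1, n1, s1) (\<xi>2, n2, s2)"
    by (simp only: \<Omega>_Y_def case_prod_conv orbit_gen_eq[OF s(1)] orbit_gen_eq[OF s(2)] k part)
  finally show ?thesis .
qed

end

theorem theorem3:
  fixes \<mu> :: "real^3"
  assumes "\<mu> \<noteq> 0"
  shows "\<Phi> \<mu> ` (SO3 \<times> U_dom \<mu>) \<subseteq> SO3 \<times> UNIV \<and>
    \<Phi> \<mu> differentiable_on (SO3 \<times> U_dom \<mu>) \<and>
    (\<forall>p \<in> SO3 \<times> U_dom \<mu>.
      \<forall>v \<in> UNIV \<times> isotropy_dual \<mu> \<times> tangent_orbit \<mu>.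
      \<forall>w \<in> UNIV \<times> isotropy_dual \<mu> \<times> tangent_orbit \<mu>.
        pullback_form (\<Phi> \<mu>) (SO3 \<times> U_dom \<mu>) \<Omega>_c p v w = \<Omega>_Y \<mu> p v w)"
proof (intro conjI)
  have "\<Phi> \<mu> (g, \<nu>, \<rho>) \<in> SO3 \<times> UNIV" if "g \<in> SO3" "(\<nu>, \<rho>) \<in> U_dom \<mu>" for g \<nu> \<rho>
    using that
    by (subst \<Phi>_eq_ext[OF assms])
      (auto simp: \<Phi>_ext_def[OF assms] Let_def mem_U_dom[OF assms] SO3_mult SO3_transpose ball_rot_SO3)
  then show "\<Phi> \<mu> ` (SO3 \<times> U_dom \<mu>) \<subseteq> SO3 \<times> UNIV" by force
  show "\<Phi> \<mu> differentiable_on (SO3 \<times> U_dom \<mu>)"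
    unfolding differentiable_on_def using has_derivative_\<Phi>[OF assms] differentiableI by fast
  show "\<forall>p \<in> SO3 \<times> U_dom \<mu>.
      \<forall>v \<in> UNIV \<times> isotropy_dual \<mu> \<times> tangent_orbit \<mu>.
      \<forall>w \<in> UNIV \<times> isotropy_dual \<mu> \<times> tangent_orbit \<mu>.
        pullback_form (\<Phi> \<mu>) (SO3 \<times> U_dom \<mu>) \<Omega>_c p v w = \<Omega>_Y \<mu> p v w"
    using pullback_\<Omega>_c[OF assms] by (auto simp: mem_tangent_orbit[OF assms])
qed

end
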